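(* There is an absolute constant $c>0$ such that for every partial Boolean function $g\subseteq\{0,1\}^m\times\{0,1\}$, $\chi(g)\ge c\sqrt{\mathrm{R}_{1/3}(g)}$, i.e. $\chi(g)\in\Omega\left(\sqrt{\mathrm{R}_{1/3}(g)}\right)$.
   Context: Partial Boolean function: $g^{-1}(b)$ is the set of $x$ with $(x,b)\in g$ and $(x,1-b)\notin g$; non-valid inputs are related to both outputs. $\mathrm{R}_{1/3}(g)$ is the minimum worst-case number of queries of a randomized query algorithm that on every input $x$ outputs a $b$ with $(x,b)\in g$ with probability at least $2/3$. Conflict complexity: a deterministic decision tree $T$ on $\{0,1\}^m$ queries index $q(v)$ at internal node $v$ and moves to child $v_0$ or $v_1$; leaves are labelled by bits; $T$ computes $g$ if it outputs $b$ on every $x\in g^{-1}(b)$. Nodes are identified with the subcubes of inputs reaching them; $d_T(v)$ is the number of vertices on the root-to-$v$ path (root has $d_T=1$); $\pi(v)$ is the parent. For distributions $\mu_0,\mu_1$ with $\mathrm{supp}(\mu_b)\subseteq g^{-1}(b)$: $p_b(v)=\Pr_{x\sim\mu_b}[x_{q(v)}=0\mid x\in v]$, $\Delta(v)=|p_0(v)-p_1(v)|$, $R(\text{root})=1$, $R(v)=R(\pi(v))\min_b\Pr_{x\sim\mu_b}[x\in v\mid x\in\pi(v)]$ (terms with $R(v)=0$ contribute $0$), and $\chi(T,(\mu_0,\mu_1))=\sum_v d_T(v)\Delta(v)R(v)$. The conflict complexity is $\chi(g)=\max_{(\mu_0,\mu_1)}\min_T\chi(T,(\mu_0,\mu_1))$,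 maximum over all such pairs and minimum over deterministic trees computing $g$. *)

theory Defs
  imports "HOL-Probability.Probability"
begin

text \<open>Bits are booleans (\<^const>\<open>False\<close> is 0), and elements of \<open>{0,1}\<^sup>m\<close> are lists of length \<open>m\<close>.\<close>

definition cube :: "nat \<Rightarrow> bool list set" where
  "cube m = {x. length x = m}"

text \<open>A partial Boolean function is a relation that is total on the cube: an input outside the
  domain is related to both outputs.\<close>

definition partial_boolean_function :: "nat \<Rightarrow> (bool list \<times> bool) set \<Rightarrow> bool" where
  "partial_boolean_function m g \<longleftrightarrow>
     g \<subseteq> cube m \<times> UNIV \<and> (\<forall>x\<in>cube m. \<exists>b. (x, b) \<in> g)"

definition preimage :: "(bool list \<times> bool) set \<Rightarrow> bool \<Rightarrow> bool list set" where
  "preimage g b = {x. (x, b) \<in> g \<and> (x, \<not> b) \<notin> g}"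

text \<open>\<open>Node i t\<^sub>0 t\<^sub>1\<close> queries index \<open>i\<close> (counted from 0) and continues with \<open>t\<^sub>0\<close> or \<open>t\<^sub>1\<close>
  according to the answer.\<close>

datatype dtree = Leaf bool | Node nat dtree dtree

fun tree_on :: "nat \<Rightarrow> dtree \<Rightarrow> bool" where
  "tree_on m (Leaf b) \<longleftrightarrow> True"
| "tree_on m (Node i t0 t1) \<longleftrightarrow> i < m \<and> tree_on m t0 \<and> tree_on m t1"

fun tree_output :: "dtree \<Rightarrow> bool list \<Rightarrow> bool" where
  "tree_output (Leaf b) x = b"
| "tree_output (Node i t0 t1) x = tree_output (if x ! i then t1 else t0) x"

fun num_queries :: "dtree \<Rightarrow> bool list \<Rightarrow> nat" where
  "num_queries (Leaf b) x = 0"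
| "num_queries (Node i t0 t1) x = Suc (num_queries (if x ! i then t1 else t0) x)"

definition computes :: "dtree \<Rightarrow> (bool list \<times> bool) set \<Rightarrow> bool" where
  "computes T g \<longleftrightarrow> (\<forall>b. \<forall>x\<in>preimage g b. tree_output T x = b)"

text \<open>A randomized query algorithm is a probability distribution on deterministic decision trees.\<close>

definition randomized_computes ::
  "real \<Rightarrow> nat \<Rightarrow> (bool list \<times> bool) set \<Rightarrow> dtree pmf \<Rightarrow> bool" where
  "randomized_computes \<epsilon> m g A \<longleftrightarrow>
     (\<forall>T\<in>set_pmf A. tree_on m T) \<and>
     (\<forall>x\<in>cube m. measure_pmf.prob A {T. (x, tree_output T x) \<in> g} \<ge> 1 - \<epsilon>)"

definition randomized_query_complexity :: "real \<Rightarrow> nat \<Rightarrow> (bool list \<times> bool) set \<Rightarrow> nat" where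
  "randomized_query_complexity \<epsilon> m g =
     (LEAST k. \<exists>A. randomized_computes \<epsilon> m g A \<and>
        (\<forall>T\<in>set_pmf A. \<forall>x\<in>cube m. num_queries T x \<le> k))"

text \<open>A vertex of a tree is represented by the list of query answers on the path from the root to
  it, so that the root is \<open>[]\<close> and the parent of \<open>v \<noteq> []\<close> is \<open>butlast v\<close>.\<close>

fun internal_nodes :: "dtree \<Rightarrow> bool list set" where
  "internal_nodes (Leaf b) = {}"
| "internal_nodes (Node i t0 t1) =
     insert [] ((#) False ` internal_nodes t0 \<union> (#) True ` internal_nodes t1)"

fun query_at :: "dtree \<Rightarrow> bool list \<Rightarrow> nat" where
  "query_at (Node i t0 t1) [] = i"
| "query_at (Node i t0 t1) (a # v) = query_at (if a then t1 else t0) v"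

fun reaches :: "dtree \<Rightarrow> bool list \<Rightarrow> bool list \<Rightarrow> bool" where
  "reaches T [] x \<longleftrightarrow> True"
| "reaches (Leaf b) (a # v) x \<longleftrightarrow> False"
| "reaches (Node i t0 t1) (a # v) x \<longleftrightarrow> x ! i = a \<and> reaches (if a then t1 else t0) v x"

definition vertex_depth :: "bool list \<Rightarrow> nat" where
  "vertex_depth v = Suc (length v)"

definition zero_prob :: "dtree \<Rightarrow> bool list pmf \<Rightarrow> bool list \<Rightarrow> real" where
  "zero_prob T \<mu> v = \<P>(x in measure_pmf \<mu>. \<not> x ! query_at T v \<bar> reaches T v x)"

definition query_gap :: "dtree \<Rightarrow> bool list pmf \<Rightarrow> bool list pmf \<Rightarrow> bool list \<Rightarrow> real" where
  "query_gap T \<mu>0 \<mu>1 v = \<bar>zero_prob T \<mu>0 v - zero_prob T \<mu>1 v\<bar>"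

text \<open>Conditional probabilities given a null event are 0 here. This is harmless: by induction along
  the path, \<open>reach_weight T \<mu>\<^sub>0 \<mu>\<^sub>1 v\<close> is at most the probability of reaching \<open>v\<close> under either
  distribution, so such a conditional probability only ever occurs multiplied by 0.\<close>

fun reach_weight :: "dtree \<Rightarrow> bool list pmf \<Rightarrow> bool list pmf \<Rightarrow> bool list \<Rightarrow> real" where
  "reach_weight T \<mu>0 \<mu>1 v =
     (if v = [] then 1
      else reach_weight T \<mu>0 \<mu>1 (butlast v) *
        min (\<P>(x in measure_pmf \<mu>0. reaches T v x \<bar> reaches T (butlast v) x))
            (\<P>(x in measure_pmf \<mu>1. reaches T v x \<bar> reaches T (butlast v) x)))"

declare reach_weight.simps [simp del]

definition tree_conflict :: "dtree \<Rightarrow> bool list pmf \<Rightarrow> bool list pmf \<Rightarrow> real" where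
  "tree_conflict T \<mu>0 \<mu>1 =
     (\<Sum>v\<in>internal_nodes T. real (vertex_depth v) * query_gap T \<mu>0 \<mu>1 v * reach_weight T \<mu>0 \<mu>1 v)"

text \<open>The values lie in \<^typ>\<open>ennreal\<close> so that supremum and infimum are unconditionally meaningful. If
  \<open>g\<close> takes only one value on its domain, there is no admissible pair of distributions and the
  supremum over the empty set is 0.\<close>

definition conflict_complexity :: "nat \<Rightarrow> (bool list \<times> bool) set \<Rightarrow> ennreal" where
  "conflict_complexity m g =
     (SUP (\<mu>0, \<mu>1) \<in> {(\<mu>0, \<mu>1). set_pmf \<mu>0 \<subseteq> preimage g False \<and> set_pmf \<mu>1 \<subseteq> preimage g True}.
        INF T \<in> {T. tree_on m T \<and> computes T g}. ennreal (tree_conflict T \<mu>0 \<mu>1))"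

end

theory Submission
  imports Defs
begin

text \<open>The potential of a tree for \<open>(\<mu>\<^sub>0, \<mu>\<^sub>1)\<close> is the Bhattacharyya coefficient of the two leaf
  distributions, i.e. the sum over the leaves \<open>\<ell>\<close> of \<open>sqrt (\<mu>\<^sub>0(\<ell>) \<mu>\<^sub>1(\<ell>))\<close>. A query at \<open>v\<close> lowers
  it by at least \<open>sqrt (\<mu>\<^sub>0(v) \<mu>\<^sub>1(v)) \<Delta>(v)\<^sup>2 / 4 \<ge> R(v) \<Delta>(v)\<^sup>2 / 4\<close>. The quantity \<open>\<Delta>(v) R(v)\<close> is the
  probability that a coupled run of the tree on both distributions has its conflict at \<open>v\<close>, and these
  probabilities add up to 1. If the expected conflict depth is at most \<open>D / 2\<close>, then half of this mass
  lies at depth at most \<open>D\<close> by Markov's inequality; there \<open>R\<close> has total mass at most \<open>D\<close>, so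
  Cauchy-Schwarz bounds the sum of \<open>R \<Delta>\<^sup>2\<close> below by \<open>1 / (4 D)\<close>, and truncation at depth \<open>D\<close> still
  multiplies the potential by at most \<open>1 - 1 / (16 D)\<close>.
  Conditioning both distributions on a leaf and starting again there, \<open>32 D\<close> phases bring the
  potential below \<open>1/4\<close> with \<open>32 D\<^sup>2\<close> queries. Labelling the leaves by maximum likelihood gives error
  at most \<open>1/8\<close> on any prescribed input distribution, and a multiplicative weights argument turns these
  trees into one randomized algorithm.\<close>

section \<open>Leaves, truncation and the affinity potential\<close>

fun leaf_nodes :: "dtree \<Rightarrow> bool list set" where
  "leaf_nodes (Leaf b) = {[]}"
| "leaf_nodes (Node i t0 t1) = (#) False ` leaf_nodes t0 \<union> (#) True ` leaf_nodes t1"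

text \<open>The label at a cut is a placeholder; final labels are chosen in
  \<open>maximum_likelihood_relabelling\<close>, after all phases.\<close>

fun truncate_tree :: "nat \<Rightarrow> dtree \<Rightarrow> dtree" where
  "truncate_tree n (Leaf b) = Leaf b"
| "truncate_tree 0 (Node i t0 t1) = Leaf False"
| "truncate_tree (Suc n) (Node i t0 t1) = Node i (truncate_tree n t0) (truncate_tree n t1)"

definition affinity :: "'a pmf \<Rightarrow> 'a pmf \<Rightarrow> 'a set \<Rightarrow> real" where
  "affinity \<mu> \<nu> S = sqrt (measure_pmf.prob \<mu> S * measure_pmf.prob \<nu> S)"

text \<open>The set \<open>S\<close> of inputs consistent with the answers so far is carried along,
  so that the potential can also be evaluated for a tree started in an inner cell, as the phases
  require.\<close>

fun tree_affinity ::
  "bool list pmf \<Rightarrow> bool list pmf \<Rightarrow> dtree \<Rightarrow> bool list set \<Rightarrow> real" where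
  "tree_affinity \<mu> \<nu> (Leaf b) S = affinity \<mu> \<nu> S"
| "tree_affinity \<mu> \<nu> (Node i t0 t1) S =
     tree_affinity \<mu> \<nu> t0 {x\<in>S. \<not> x ! i} + tree_affinity \<mu> \<nu> t1 {x\<in>S. x ! i}"

lemma affinity_UNIV [simp]: "affinity \<mu> \<nu> UNIV = 1"
  by (simp add: affinity_def)

lemma finite_internal_nodes [simp]: "finite (internal_nodes T)"
  by (induction T) auto

lemma tree_on_truncate: "tree_on m T \<Longrightarrow> tree_on m (truncate_tree n T)"
  by (induction n T rule: truncate_tree.induct) auto

lemma num_queries_truncate_le: "num_queries (truncate_tree n T) x \<le> n"
  by (induction n T rule: truncate_tree.induct) auto

section \<open>Telescoping sums over the vertices of a tree\<close>

lemma sum_internal_nodes_Node: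
  fixes c :: "bool list \<Rightarrow> real"
  shows "(\<Sum>v\<in>internal_nodes (Node i t0 t1). c v) =
    c [] + (\<Sum>v\<in>internal_nodes t0. c (False # v)) + (\<Sum>v\<in>internal_nodes t1. c (True # v))"
proof -
  have "(\<Sum>v\<in>internal_nodes (Node i t0 t1). c v) =
      c [] + sum c ((#) False ` internal_nodes t0 \<union> (#) True ` internal_nodes t1)"
    by (simp, subst sum.insert) auto
  also have "sum c ((#) False ` internal_nodes t0 \<union> (#) True ` internal_nodes t1) =
      sum c ((#) False ` internal_nodes t0) + sum c ((#) True ` internal_nodes t1)"
    by (rule sum.union_disjoint) auto
  finally show ?thesis
    by (simp add: sum.reindex)
qed

text \<open>Telescoping: \<open>c\<close> pays for every drop of the potential \<open>f\<close> on
  the way down, and nothing positive is left at the leaves.\<close>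

lemma sum_internal_nodes_ge:
  fixes f c :: "bool list \<Rightarrow> real"
  assumes "\<And>v. v \<in> internal_nodes T \<Longrightarrow> f v \<le> c v + f (v @ [False]) + f (v @ [True])"
    and "\<And>v. v \<in> leaf_nodes T \<Longrightarrow> f v \<le> 0"
  shows "f [] \<le> (\<Sum>v\<in>internal_nodes T. c v)"
  using assms
proof (induction T arbitrary: f c)
  case (Leaf b)
  then show ?case by simp
next
  case (Node i t0 t1)
  have "f [False] \<le> (\<Sum>v\<in>internal_nodes t0. c (False # v))"
    using Node.prems by (intro Node.IH(1)[of "\<lambda>v. f (False # v)"]) (auto simp flip: append_Cons)
  moreover have "f [True] \<le> (\<Sum>v\<in>internal_nodes t1. c (True # v))"
    using Node.prems by (intro Node.IH(2)[of "\<lambda>v. f (True # v)"]) (auto simp flip: append_Cons)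
  moreover have "f [] \<le> c [] + f [False] + f [True]"
    using Node.prems(1)[of "[]"] by simp
  ultimately show ?case
    unfolding sum_internal_nodes_Node by linarith
qed

text \<open>Telescoping in the reverse direction; nonnegativity of \<open>f\<close> disposes of the
  leaves.\<close>

lemma sum_internal_nodes_le:
  fixes f c :: "bool list \<Rightarrow> real"
  assumes "\<And>v. v \<in> internal_nodes T \<Longrightarrow> c v + f (v @ [False]) + f (v @ [True]) \<le> f v"
    and "\<And>v. 0 \<le> f v"
  shows "(\<Sum>v\<in>internal_nodes T. c v) \<le> f []"
  using assms
proof (induction T arbitrary: f c)
  case (Leaf b)
  then show ?case by simp
next
  case (Node i t0 t1)
  have "(\<Sum>v\<in>internal_nodes t0. c (False # v)) \<le> f [False]"
    using Node.prems by (intro Node.IH(1)[of _ "\<lambda>v. f (False # v)"]) (auto simp flip: append_Cons)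
  moreover have "(\<Sum>v\<in>internal_nodes t1. c (True # v)) \<le> f [True]"
    using Node.prems by (intro Node.IH(2)[of _ "\<lambda>v. f (True # v)"]) (auto simp flip: append_Cons)
  moreover have "c [] + f [False] + f [True] \<le> f []"
    using Node.prems(1)[of "[]"] by simp
  ultimately show ?case
    unfolding sum_internal_nodes_Node by linarith
qed

text \<open>\<open>reaches\<close> recurses from the root, whereas \<open>reach_weight\<close> grows
  a path at its far end; this connects the two directions.\<close>

lemma reaches_snoc:
  "v \<in> internal_nodes T \<Longrightarrow>
    reaches T (v @ [a]) x \<longleftrightarrow> reaches T v x \<and> x ! query_at T v = a"
proof (induction T arbitrary: v)
  case (Node i t0 t1)
  then show ?case by (cases v) (auto simp: image_iff)
qed simp

lemma reaches_snocD: "reaches T (v @ [a]) x \<Longrightarrow> reaches T v x"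
  by (induction T v x rule: reaches.induct) auto

lemma reaches_leaf_output:
  "v \<in> leaf_nodes T \<Longrightarrow> \<exists>b. \<forall>x. reaches T v x \<longrightarrow> tree_output T x = b"
proof (induction T arbitrary: v)
  case (Node i t0 t1)
  from Node.prems consider w where "v = False # w" "w \<in> leaf_nodes t0"
    | w where "v = True # w" "w \<in> leaf_nodes t1" by auto
  then show ?case
    using Node.IH by cases (force, force)
qed simp

text \<open>Every query replaces the affinity of its cell by those of the two subcells, so the
  losses telescope; truncation drops the losses at \<open>length v \<ge> n\<close>.\<close>

lemma tree_affinity_truncate:
  "tree_affinity \<mu> \<nu> (truncate_tree n T) S = affinity \<mu> \<nu> S -
     (\<Sum>v\<in>internal_nodes T. if length v < n then
        affinity \<mu> \<nu> {x\<in>S. reaches T v x} - affinity \<mu> \<nu> {x\<in>S. reaches T (v @ [False]) x}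
        - affinity \<mu> \<nu> {x\<in>S. reaches T (v @ [True]) x} else 0)"
proof (induction n T arbitrary: S rule: truncate_tree.induct)
  case (3 n i t0 t1)
  show ?case
    unfolding sum_internal_nodes_Node truncate_tree.simps tree_affinity.simps 3
    by (simp add: conj_assoc cong: if_cong)
qed simp_all

text \<open>\<open>sqrt (p * q)\<close> is the mean of \<open>p\<close> and \<open>q\<close> minus
  half of \<open>(sqrt p - sqrt q)\<^sup>2\<close>, and this square is at least
  \<open>(p - q)\<^sup>2 / 4\<close> because \<open>sqrt p + sqrt q \<le> 2\<close>. The means for
  the two answers add up to 1.\<close>

lemma one_minus_binary_affinity_ge:
  fixes a b :: real
  assumes "0 \<le> a" "a \<le> 1" "0 \<le> b" "b \<le> 1"
  shows "(a - b)\<^sup>2 / 4 \<le> 1 - sqrt (a * b) - sqrt ((1 - a) * (1 - b))"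
proof -
  have *: "sqrt (p * q) \<le> (p + q) / 2 - (p - q)\<^sup>2 / 8"
    if "0 \<le> p" "p \<le> 1" "0 \<le> q" "q \<le> 1" for p q :: real
  proof -
    have "(p - q)\<^sup>2 = (sqrt p - sqrt q)\<^sup>2 * (sqrt p + sqrt q)\<^sup>2"
      using that by (simp flip: power_mult_distrib add: algebra_simps)
    also have "\<dots> \<le> (sqrt p - sqrt q)\<^sup>2 * 2\<^sup>2"
      using that add_mono[of "sqrt p" 1 "sqrt q" 1]
      by (intro mult_left_mono power_mono) simp_all
    also have "(sqrt p - sqrt q)\<^sup>2 = p + q - 2 * sqrt (p * q)"
      using that by (simp add: power2_diff real_sqrt_mult)
    finally show ?thesis by (simp add: field_simps)
  qed
  have "sqrt ((1 - a) * (1 - b)) \<le> (2 - a - b) / 2 - (a - b)\<^sup>2 / 8"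
    using *[of "1 - a" "1 - b"] assms by (simp add: power2_commute[of b a] algebra_simps)
  moreover have "sqrt (a * b) \<le> (a + b) / 2 - (a - b)\<^sup>2 / 8"
    using * assms by simp
  ultimately show ?thesis
    by (simp add: field_simps)
qed

section \<open>Reach probabilities, coupled weights and the loss per query\<close>

definition reach_prob :: "dtree \<Rightarrow> bool list pmf \<Rightarrow> bool list \<Rightarrow> real" where
  "reach_prob T \<mu> v = measure_pmf.prob \<mu> {x. reaches T v x}"

lemma reach_prob_nonneg: "0 \<le> reach_prob T \<mu> v"
  by (simp add: reach_prob_def)

lemma cond_prob_pmf_bounds: "0 \<le> \<P>(x in measure_pmf \<mu>. P x \<bar> Q x)"
    "\<P>(x in measure_pmf \<mu>. P x \<bar> Q x) \<le> 1"
proof -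
  have "measure_pmf.prob \<mu> {x. P x \<and> Q x} \<le> measure_pmf.prob \<mu> {x. Q x}"
    by (rule measure_pmf.finite_measure_mono) auto
  then show "\<P>(x in measure_pmf \<mu>. P x \<bar> Q x) \<le> 1"
    by (simp add: cond_prob_def divide_le_eq_1 zero_less_measure_iff)
qed (simp add: cond_prob_def)

text \<open>True also when \<open>v\<close> has probability 0: both sides vanish then, whatever the
  value of the conditional probability.\<close>

lemma reach_prob_snoc:
  assumes "v \<in> internal_nodes T"
  shows "reach_prob T \<mu> (v @ [False]) = reach_prob T \<mu> v * zero_prob T \<mu> v"
    and "reach_prob T \<mu> (v @ [True]) = reach_prob T \<mu> v * (1 - zero_prob T \<mu> v)"
proof -
  let ?F = "{x. reaches T (v @ [False]) x}" and ?T = "{x. reaches T (v @ [True]) x}"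
  have "reach_prob T \<mu> (v @ [False]) \<le> reach_prob T \<mu> v"
    unfolding reach_prob_def
    by (rule measure_pmf.finite_measure_mono) (auto dest: reaches_snocD)
  moreover have "zero_prob T \<mu> v = reach_prob T \<mu> (v @ [False]) / reach_prob T \<mu> v"
    using assms by (simp add: zero_prob_def cond_prob_def reach_prob_def reaches_snoc conj_commute)
  ultimately show F: "reach_prob T \<mu> (v @ [False]) = reach_prob T \<mu> v * zero_prob T \<mu> v"
    using reach_prob_nonneg[of T \<mu> "v @ [False]"] by (cases "reach_prob T \<mu> v = 0") auto
  have "{x. reaches T v x} = ?F \<union> ?T" "?F \<inter> ?T = {}"
    using assms by (auto simp: reaches_snoc)
  then have "reach_prob T \<mu> v = reach_prob T \<mu> (v @ [False]) + reach_prob T \<mu> (v @ [True])"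
    by (simp add: reach_prob_def measure_pmf.finite_measure_Union)
  then show "reach_prob T \<mu> (v @ [True]) = reach_prob T \<mu> v * (1 - zero_prob T \<mu> v)"
    using F by (simp add: algebra_simps)
qed

lemma query_gap_nonneg: "0 \<le> query_gap T \<mu> \<nu> v"
  by (simp add: query_gap_def)

lemma reach_weight_Nil: "reach_weight T \<mu> \<nu> [] = 1"
  by (simp add: reach_weight.simps)

lemma reach_weight_snoc:
  "reach_weight T \<mu> \<nu> (v @ [a]) = reach_weight T \<mu> \<nu> v *
     min (reach_prob T \<mu> (v @ [a]) / reach_prob T \<mu> v) (reach_prob T \<nu> (v @ [a]) / reach_prob T \<nu> v)"
proof -
  have "{x. reaches T (v @ [a]) x \<and> reaches T v x} = {x. reaches T (v @ [a]) x}"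
    by (auto dest: reaches_snocD)
  then show ?thesis
    by (subst reach_weight.simps) (simp add: cond_prob_def reach_prob_def)
qed

lemma reach_weight_nonneg: "0 \<le> reach_weight T \<mu> \<nu> v"
  by (induction v rule: rev_induct) (simp_all add: reach_weight_Nil reach_weight_snoc reach_prob_nonneg)

text \<open>The minimum is at most either conditional probability, and the product of these along
  the path telescopes to the reach probability. Below a vertex of probability 0 the weight is 0 as
  well.\<close>

lemma reach_weight_le:
  "reach_weight T \<mu> \<nu> v \<le> reach_prob T \<mu> v \<and> reach_weight T \<mu> \<nu> v \<le> reach_prob T \<nu> v"
proof (induction v rule: rev_induct)
  case Nil
  then show ?case by (simp add: reach_weight_Nil reach_prob_def)
next
  case (snoc a v)
  have *: "reach_weight T \<mu> \<nu> v * min p q \<le> r'"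
    if "reach_weight T \<mu> \<nu> v \<le> r" "min p q \<le> r' / r" "0 \<le> min p q" "0 \<le> r'" for p q r r' :: real
  proof -
    have "reach_weight T \<mu> \<nu> v * min p q \<le> r * (r' / r)"
      using that reach_weight_nonneg[of T \<mu> \<nu> v] by (intro mult_mono) linarith+
    also have "\<dots> \<le> r'"
      using that by (cases "r = 0") auto
    finally show ?thesis .
  qed
  show ?case
    unfolding reach_weight_snoc using snoc.IH
    by (auto intro: *[of "reach_prob T \<mu> v"] *[of "reach_prob T \<nu> v"] simp: reach_prob_nonneg)
qed

text \<open>In a maximal coupling of the two answers at \<open>v\<close>, they differ with
  probability \<open>\<bar>p - q\<bar>\<close>, and agree on 0 or on 1 with probability
  \<open>min p q\<close> or \<open>min (1 - p) (1 - q)\<close>; the three add up to 1.\<close>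

lemma reach_weight_split:
  assumes "v \<in> internal_nodes T"
  shows "reach_weight T \<mu> \<nu> v = query_gap T \<mu> \<nu> v * reach_weight T \<mu> \<nu> v
    + reach_weight T \<mu> \<nu> (v @ [False]) + reach_weight T \<mu> \<nu> (v @ [True])"
proof (cases "reach_weight T \<mu> \<nu> v = 0")
  case True
  then show ?thesis by (simp add: reach_weight_snoc)
next
  case False
  let ?p = "zero_prob T \<mu> v" and ?q = "zero_prob T \<nu> v"
  \<comment> \<open>A nonzero weight makes both denominators in \<open>reach_weight_snoc\<close>
    nonzero, so they cancel.\<close>
  have "reach_prob T \<mu> v \<noteq> 0" "reach_prob T \<nu> v \<noteq> 0"
    using False reach_weight_le[of T \<mu> \<nu> v] reach_weight_nonneg[of T \<mu> \<nu> v] by linarith+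
  then have "reach_weight T \<mu> \<nu> (v @ [False]) = reach_weight T \<mu> \<nu> v * min ?p ?q"
    "reach_weight T \<mu> \<nu> (v @ [True]) = reach_weight T \<mu> \<nu> v * min (1 - ?p) (1 - ?q)"
    by (simp_all add: reach_weight_snoc reach_prob_snoc[OF assms])
  moreover have "\<bar>?p - ?q\<bar> + min ?p ?q + min (1 - ?p) (1 - ?q) = 1"
    by auto
  ultimately show ?thesis
    unfolding query_gap_def by (metis distrib_left mult.commute mult.right_neutral)
qed

text \<open>Squared Hellinger distance dominates squared total variation distance, applied to the answer
  of the query at \<open>v\<close>.\<close>

lemma affinity_loss_ge:
  assumes "v \<in> internal_nodes T"
  shows "reach_weight T \<mu> \<nu> v * (query_gap T \<mu> \<nu> v)\<^sup>2 / 4 \<le>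
    affinity \<mu> \<nu> {x. reaches T v x} - affinity \<mu> \<nu> {x. reaches T (v @ [False]) x}
      - affinity \<mu> \<nu> {x. reaches T (v @ [True]) x}"
proof -
  let ?p = "zero_prob T \<mu> v" and ?q = "zero_prob T \<nu> v" and ?A = "affinity \<mu> \<nu> {x. reaches T v x}"
  have pq: "0 \<le> ?p" "?p \<le> 1" "0 \<le> ?q" "?q \<le> 1"
    by (simp_all add: zero_prob_def cond_prob_pmf_bounds)
  have "(reach_weight T \<mu> \<nu> v)\<^sup>2 \<le> reach_prob T \<mu> v * reach_prob T \<nu> v"
    unfolding power2_eq_square using reach_weight_le[of T \<mu> \<nu> v] reach_weight_nonneg[of T \<mu> \<nu> v]
    by (intro mult_mono) (auto simp: reach_prob_nonneg)
  then have "reach_weight T \<mu> \<nu> v \<le> ?A"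
    unfolding affinity_def reach_prob_def by (rule real_le_rsqrt)
  moreover have "(query_gap T \<mu> \<nu> v)\<^sup>2 / 4 \<le> 1 - sqrt (?p * ?q) - sqrt ((1 - ?p) * (1 - ?q))"
    using one_minus_binary_affinity_ge[OF pq] by (simp add: query_gap_def)
  ultimately have "reach_weight T \<mu> \<nu> v * ((query_gap T \<mu> \<nu> v)\<^sup>2 / 4) \<le>
      ?A * (1 - sqrt (?p * ?q) - sqrt ((1 - ?p) * (1 - ?q)))"
    by (intro mult_mono) (auto simp: affinity_def)
  moreover have "affinity \<mu> \<nu> {x. reaches T (v @ [False]) x} = ?A * sqrt (?p * ?q)"
    "affinity \<mu> \<nu> {x. reaches T (v @ [True]) x} = ?A * sqrt ((1 - ?p) * (1 - ?q))"
    unfolding affinity_def reach_prob_def[symmetric] reach_prob_snoc[OF assms]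
    by (simp_all add: mult_ac flip: real_sqrt_mult)
  ultimately show ?thesis by (simp add: algebra_simps)
qed

section \<open>Conflict mass and the affinity of a truncated tree\<close>

text \<open>A coupled run without conflict is at no more than one vertex per level, so each of the
  \<open>n\<close> levels has total weight at most 1.\<close>

lemma sum_reach_weight_shallow_le:
  "(\<Sum>v\<in>internal_nodes T. if length v < n then reach_weight T \<mu> \<nu> v else 0) \<le> real n"
proof -
  have "(\<Sum>v\<in>internal_nodes T. if length v < n then reach_weight T \<mu> \<nu> v else 0)
      \<le> real (n - length ([] :: bool list)) * reach_weight T \<mu> \<nu> []"
  \<comment> \<open>The potential is the number of levels left times the weight; subtraction on
    naturals makes it vanish from level \<open>n\<close> on.\<close>
  proof (rule sum_internal_nodes_le[where f = "\<lambda>v. real (n - length v) * reach_weight T \<mu> \<nu> v"])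
    fix v assume "v \<in> internal_nodes T"
    then have "reach_weight T \<mu> \<nu> (v @ [False]) + reach_weight T \<mu> \<nu> (v @ [True]) \<le> reach_weight T \<mu> \<nu> v"
      using reach_weight_split[of v T \<mu> \<nu>]
        mult_nonneg_nonneg[OF query_gap_nonneg[of T \<mu> \<nu> v] reach_weight_nonneg[of T \<mu> \<nu> v]]
      by linarith
    then have "real (n - Suc (length v)) *
        (reach_weight T \<mu> \<nu> (v @ [False]) + reach_weight T \<mu> \<nu> (v @ [True]))
        \<le> real (n - Suc (length v)) * reach_weight T \<mu> \<nu> v"
      by (intro mult_left_mono) auto
    moreover have "real (n - length v) = 1 + real (n - Suc (length v))" if "length v < n"
      using that by linarith
    ultimately show "(if length v < n then reach_weight T \<mu> \<nu> v else 0) +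
        real (n - length (v @ [False])) * reach_weight T \<mu> \<nu> (v @ [False]) +
        real (n - length (v @ [True])) * reach_weight T \<mu> \<nu> (v @ [True])
        \<le> real (n - length v) * reach_weight T \<mu> \<nu> v"
      by (auto simp: algebra_simps)
  qed (simp add: reach_weight_nonneg)
  then show ?thesis by (simp add: reach_weight_Nil)
qed

text \<open>A run that reaches a leaf without conflict would be consistent with both values of \<open>g\<close>, so
  the conflict occurs almost surely.\<close>

lemma sum_conflict_prob_ge_1:
  assumes "computes T g" "set_pmf \<mu> \<subseteq> preimage g False" "set_pmf \<nu> \<subseteq> preimage g True"
  shows "1 \<le> (\<Sum>v\<in>internal_nodes T. query_gap T \<mu> \<nu> v * reach_weight T \<mu> \<nu> v)"
proof -
  have "reach_weight T \<mu> \<nu> [] \<le> (\<Sum>v\<in>internal_nodes T. query_gap T \<mu> \<nu> v * reach_weight T \<mu> \<nu> v)"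
  proof (rule sum_internal_nodes_ge)
    fix v assume "v \<in> leaf_nodes T"
    then obtain b where b: "\<And>x. reaches T v x \<Longrightarrow> tree_output T x = b"
      using reaches_leaf_output by blast
    have "reach_prob T (if b then \<mu> else \<nu>) v = 0"
      using assms b unfolding reach_prob_def computes_def
      by (cases b) (auto simp: measure_pmf_zero_iff, blast+)
    then show "reach_weight T \<mu> \<nu> v \<le> 0"
      using reach_weight_le[of T \<mu> \<nu> v] by (cases b) auto
  qed (use reach_weight_split in simp)
  then show ?thesis by (simp add: reach_weight_Nil)
qed

text \<open>Every conflict has depth at least 1. This keeps the truncation depth, and later the
  complexity itself, away from 0.\<close>

lemma tree_conflict_ge_1:
  assumes "computes T g" "set_pmf \<mu> \<subseteq> preimage g False" "set_pmf \<nu> \<subseteq> preimage g True"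
  shows "1 \<le> tree_conflict T \<mu> \<nu>"
proof -
  have "1 \<le> (\<Sum>v\<in>internal_nodes T. query_gap T \<mu> \<nu> v * reach_weight T \<mu> \<nu> v)"
    by (rule sum_conflict_prob_ge_1[OF assms])
  also have "\<dots> \<le> tree_conflict T \<mu> \<nu>"
    unfolding tree_conflict_def mult.assoc
    using mult_right_mono[of 1 "real (vertex_depth v)" "query_gap T \<mu> \<nu> v * reach_weight T \<mu> \<nu> v" for v]
    by (intro sum_mono) (simp add: vertex_depth_def query_gap_nonneg reach_weight_nonneg)
  finally show ?thesis .
qed

text \<open>Markov and Cauchy-Schwarz are merged into one pointwise inequality, which is then summed
  over all vertices.\<close>

lemma tree_affinity_truncate_le:
  assumes T: "computes T g" "set_pmf \<mu> \<subseteq> preimage g False" "set_pmf \<nu> \<subseteq> preimage g True"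
    and D: "2 * tree_conflict T \<mu> \<nu> \<le> real D"
  shows "tree_affinity \<mu> \<nu> (truncate_tree D T) UNIV \<le> 1 - 1 / (16 * real D)"
proof -
  define N where "N = internal_nodes T"
  define R where "R = reach_weight T \<mu> \<nu>"
  define \<Delta> where "\<Delta> = query_gap T \<mu> \<nu>"
  define K where "K = (\<Sum>v\<in>N. if length v < D then R v * (\<Delta> v)\<^sup>2 else 0)"
  have D_pos: "0 < real D"
    using D tree_conflict_ge_1[OF T] by linarith
  have nonneg: "0 \<le> \<Delta> v" "0 \<le> R v" for v
    by (simp_all add: \<Delta>_def R_def query_gap_nonneg reach_weight_nonneg)
  \<comment> \<open>Deep vertices are paid for by the first summand (Markov), shallow ones by the
    other two.\<close>
  have "\<Delta> v * R v \<le> real (vertex_depth v) * \<Delta> v * R v / real D +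
      (real D * (if length v < D then R v * (\<Delta> v)\<^sup>2 else 0)
       + (if length v < D then R v else 0) / (4 * real D))" for v
  proof (cases "length v < D")
    case True
    \<comment> \<open>AM-GM instead of Cauchy-Schwarz, balanced so that the constant term, summed
      against a shallow weight of at most \<open>D\<close>, costs at most 1/4.\<close>
    have "\<Delta> v \<le> real D * (\<Delta> v)\<^sup>2 + 1 / (4 * real D)"
    proof -
      have "0 \<le> (2 * real D * \<Delta> v - 1)\<^sup>2 / (4 * real D)"
        using D_pos by simp
      also have "\<dots> = real D * (\<Delta> v)\<^sup>2 + 1 / (4 * real D) - \<Delta> v"
        using D_pos by (simp add: field_simps power2_eq_square)
      finally show ?thesis by simp
    qed
    then have "\<Delta> v * R v \<le> (real D * (\<Delta> v)\<^sup>2 + 1 / (4 * real D)) * R v"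
      using nonneg by (intro mult_right_mono)
    moreover have "0 \<le> real (vertex_depth v) * \<Delta> v * R v / real D"
      using nonneg by simp
    ultimately show ?thesis
      using True by (simp add: algebra_simps)
  next
    case False
    \<comment> \<open>Depth counts vertices, so \<open>length v \<ge> D\<close> means
      \<open>vertex_depth v > D\<close>.\<close>
    then have "1 * (\<Delta> v * R v) \<le> real (vertex_depth v) / real D * (\<Delta> v * R v)"
      using D_pos nonneg by (intro mult_right_mono) (auto simp: vertex_depth_def)
    then show ?thesis using False by (simp add: mult_ac)
  qed
  then have "(\<Sum>v\<in>N. \<Delta> v * R v) \<le> (\<Sum>v\<in>N. real (vertex_depth v) * \<Delta> v * R v / real D +
      (real D * (if length v < D then R v * (\<Delta> v)\<^sup>2 else 0)
       + (if length v < D then R v else 0) / (4 * real D)))"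
    by (rule sum_mono)
  also have "\<dots> = tree_conflict T \<mu> \<nu> / real D + (real D * K
      + (\<Sum>v\<in>N. if length v < D then R v else 0) / (4 * real D))"
    by (simp add: sum.distrib sum_divide_distrib sum_distrib_left K_def
        tree_conflict_def N_def R_def \<Delta>_def)
  also have "\<dots> \<le> 1 / 2 + (real D * K + real D / (4 * real D))"
    using D D_pos sum_reach_weight_shallow_le[where n = D and T = T and \<mu> = \<mu> and \<nu> = \<nu>]
    by (intro add_mono divide_right_mono) (simp_all add: N_def R_def field_simps cong: if_cong)
  \<comment> \<open>Of the conflict mass of at least 1, the Markov term takes at most 1/2 and the
    constant term at most 1/4.\<close>
  finally have "1 / 4 \<le> real D * K"
    using D_pos sum_conflict_prob_ge_1[OF T] by (simp add: N_def R_def \<Delta>_def)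
  then have "1 / (16 * real D) \<le> K / 4"
    using D_pos by (simp add: field_simps)
  moreover have "tree_affinity \<mu> \<nu> (truncate_tree D T) UNIV \<le> 1 - K / 4"
    unfolding tree_affinity_truncate K_def sum_divide_distrib N_def R_def \<Delta>_def
    using affinity_loss_ge[of _ T \<mu> \<nu>] affinity_UNIV[of \<mu> \<nu>]
    by (intro diff_mono sum_mono) (auto split: if_split)
  ultimately show ?thesis by linarith
qed

section \<open>Conditioning on a cell and iterating phases\<close>

lemma prob_cond_pmf:
  assumes "measure_pmf.prob \<mu> S \<noteq> 0"
  shows "measure_pmf.prob (cond_pmf \<mu> S) A = measure_pmf.prob \<mu> (S \<inter> A) / measure_pmf.prob \<mu> S"
proof -
  have ne: "set_pmf \<mu> \<inter> S \<noteq> {}"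
    using assms by (simp add: measure_pmf_zero_iff)
  have "emeasure \<mu> S \<noteq> 0"
    using assms by (simp add: measure_pmf.emeasure_eq_measure)
  then show ?thesis
    by (simp add: cond_pmf.rep_eq[OF ne] measure_pmf.emeasure_eq_measure)
qed

lemma affinity_cond_pmf:
  assumes "measure_pmf.prob \<mu> S \<noteq> 0" "measure_pmf.prob \<nu> S \<noteq> 0"
  shows "affinity \<mu> \<nu> (S \<inter> A) = affinity \<mu> \<nu> S * affinity (cond_pmf \<mu> S) (cond_pmf \<nu> S) A"
  using assms by (simp add: affinity_def prob_cond_pmf flip: real_sqrt_mult)

text \<open>Conditioning on \<open>S\<close> divides out the affinity of \<open>S\<close>, so a tree
  started in that cell contracts affinity by the factor it achieves on the conditional
  distributions.\<close>

lemma tree_affinity_cond_pmf: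
  assumes "measure_pmf.prob \<mu> S \<noteq> 0" "measure_pmf.prob \<nu> S \<noteq> 0"
  shows "tree_affinity \<mu> \<nu> t (S \<inter> A) =
    affinity \<mu> \<nu> S * tree_affinity (cond_pmf \<mu> S) (cond_pmf \<nu> S) t A"
proof (induction t arbitrary: A)
  case (Leaf b)
  then show ?case using affinity_cond_pmf[OF assms] by simp
next
  case (Node i t0 t1)
  have "{x \<in> S \<inter> A. P x} = S \<inter> {x\<in>A. P x}" for P
    by auto
  then show ?case by (simp add: Node.IH distrib_left)
qed

text \<open>A tree adapted to the cell is grafted onto each leaf of \<open>t\<close>; the
  contraction holds cell by cell, hence for the sum.\<close>

lemma extend_tree_affinity:
  assumes "\<And>S. \<exists>u. tree_on m u \<and> (\<forall>x. num_queries u x \<le> d)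
      \<and> tree_affinity \<mu> \<nu> u S \<le> \<gamma> * affinity \<mu> \<nu> S"
    and "tree_on m t"
  shows "\<exists>u. tree_on m u \<and> (\<forall>x. num_queries u x \<le> num_queries t x + d)
      \<and> tree_affinity \<mu> \<nu> u S \<le> \<gamma> * tree_affinity \<mu> \<nu> t S"
  using assms(2)
proof (induction t arbitrary: S)
  case (Leaf b)
  then show ?case using assms(1)[of S] by simp
next
  case (Node i t0 t1)
  obtain u0 where u0: "tree_on m u0" "\<And>x. num_queries u0 x \<le> num_queries t0 x + d"
    "tree_affinity \<mu> \<nu> u0 {x\<in>S. \<not> x ! i} \<le> \<gamma> * tree_affinity \<mu> \<nu> t0 {x\<in>S. \<not> x ! i}"
    using Node by fastforce
  obtain u1 where u1: "tree_on m u1" "\<And>x. num_queries u1 x \<le> num_queries t1 x + d"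
    "tree_affinity \<mu> \<nu> u1 {x\<in>S. x ! i} \<le> \<gamma> * tree_affinity \<mu> \<nu> t1 {x\<in>S. x ! i}"
    using Node by fastforce
  show ?case
    using Node.prems u0 u1 by (intro exI[of _ "Node i u0 u1"]) (auto simp: distrib_left)
qed

lemma iterated_tree_affinity:
  assumes phase: "\<And>\<mu> \<nu>. set_pmf \<mu> \<subseteq> X0 \<Longrightarrow> set_pmf \<nu> \<subseteq> X1 \<Longrightarrow>
      \<exists>t. tree_on m t \<and> (\<forall>x. num_queries t x \<le> d) \<and> tree_affinity \<mu> \<nu> t UNIV \<le> \<gamma>"
    and \<gamma>: "0 \<le> \<gamma>"
    and supp: "set_pmf \<mu> \<subseteq> X0" "set_pmf \<nu> \<subseteq> X1"
  shows "\<exists>t. tree_on m t \<and> (\<forall>x. num_queries t x \<le> r * d) \<and> tree_affinity \<mu> \<nu> t UNIV \<le> \<gamma> ^ r"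
proof (induction r)
  case 0
  show ?case by (intro exI[of _ "Leaf False"]) simp
next
  case (Suc r)
  then obtain t where t: "tree_on m t" "\<And>x. num_queries t x \<le> r * d" "tree_affinity \<mu> \<nu> t UNIV \<le> \<gamma> ^ r"
    by blast
  have "\<exists>u. tree_on m u \<and> (\<forall>x. num_queries u x \<le> d) \<and> tree_affinity \<mu> \<nu> u S \<le> \<gamma> * affinity \<mu> \<nu> S" for S
  proof (cases "measure_pmf.prob \<mu> S = 0 \<or> measure_pmf.prob \<nu> S = 0")
    case True
    \<comment> \<open>A cell missed by one distribution has no affinity left to reduce; in all other
      cells both conditional distributions exist.\<close>
    then have "affinity \<mu> \<nu> S = 0" by (auto simp: affinity_def)
    then show ?thesis by (intro exI[of _ "Leaf False"]) simp
  next
    case False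
    then have "set_pmf \<mu> \<inter> S \<noteq> {}" "set_pmf \<nu> \<inter> S \<noteq> {}"
      by (simp_all add: measure_pmf_zero_iff)
    \<comment> \<open>Conditioning only shrinks supports, so the phase assumption, being uniform
      over all pairs, applies again.\<close>
    then have "set_pmf (cond_pmf \<mu> S) \<subseteq> X0" "set_pmf (cond_pmf \<nu> S) \<subseteq> X1"
      using supp by auto
    from phase[OF this] obtain u where u: "tree_on m u" "\<forall>x. num_queries u x \<le> d"
      "tree_affinity (cond_pmf \<mu> S) (cond_pmf \<nu> S) u UNIV \<le> \<gamma>"
      by blast
    have "tree_affinity \<mu> \<nu> u S \<le> affinity \<mu> \<nu> S * \<gamma>"
      using u(3) tree_affinity_cond_pmf[of \<mu> S \<nu> u UNIV] False
      by (auto simp: affinity_def intro!: mult_left_mono)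
    then show ?thesis using u by (auto simp: mult.commute)
  qed
  from extend_tree_affinity[of m d \<mu> \<nu> \<gamma>, OF this t(1)] obtain u where u: "tree_on m u"
    "\<And>x. num_queries u x \<le> num_queries t x + d" "tree_affinity \<mu> \<nu> u UNIV \<le> \<gamma> * tree_affinity \<mu> \<nu> t UNIV"
    by blast
  have "num_queries u x \<le> Suc r * d" for x
    using u(2)[of x] t(2)[of x] by simp
  moreover have "tree_affinity \<mu> \<nu> u UNIV \<le> \<gamma> ^ Suc r"
    using u(3) mult_left_mono[OF t(3) \<gamma>] by simp
  ultimately show ?case using u(1) by blast
qed

section \<open>Maximum likelihood labelling of the leaves\<close>

text \<open>If the two labels of a leaf have error masses \<open>p\<close> and \<open>q\<close>, the
  better one errs with mass \<open>min p q \<le> sqrt (p * q)\<close>. The factors \<open>a\<close>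
  and \<open>b\<close> are the prior weights of the two values.\<close>

lemma maximum_likelihood_relabelling:
  fixes a b :: real
  assumes "0 \<le> a" "0 \<le> b" "tree_on m t"
  shows "\<exists>u. tree_on m u \<and> (\<forall>x. num_queries u x = num_queries t x) \<and>
    a * measure_pmf.prob \<mu> {x\<in>S. tree_output u x} + b * measure_pmf.prob \<nu> {x\<in>S. \<not> tree_output u x}
      \<le> sqrt (a * b) * tree_affinity \<mu> \<nu> t S"
  using assms(3)
proof (induction t arbitrary: S)
  case (Leaf c)
  have min_le: "min p q \<le> sqrt (p * q)" if "0 \<le> p" "0 \<le> q" for p q :: real
    using that by (intro real_le_rsqrt) (auto simp: min_def power2_eq_square intro: mult_mono)
  let ?p = "a * measure_pmf.prob \<mu> S" and ?q = "b * measure_pmf.prob \<nu> S"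
  have "min ?p ?q \<le> sqrt (?p * ?q)"
    using assms by (intro min_le) auto
  also have "?p * ?q = (a * b) * (measure_pmf.prob \<mu> S * measure_pmf.prob \<nu> S)"
    by simp
  also have "sqrt \<dots> = sqrt (a * b) * tree_affinity \<mu> \<nu> (Leaf c) S"
    by (simp only: real_sqrt_mult affinity_def tree_affinity.simps)
  finally show ?case
    \<comment> \<open>Answering \<open>True\<close> errs on the mass of \<open>\<mu>\<close>, hence
      the direction of the comparison.\<close>
    by (intro exI[of _ "Leaf (?p \<le> ?q)"]) (cases "?p \<le> ?q", simp_all)
next
  case (Node i t0 t1)
  define S0 S1 where "S0 = {x\<in>S. \<not> x ! i}" and "S1 = {x\<in>S. x ! i}"
  obtain u0 where u0: "tree_on m u0" "\<And>x. num_queries u0 x = num_queries t0 x"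
    "a * measure_pmf.prob \<mu> {x\<in>S0. tree_output u0 x} + b * measure_pmf.prob \<nu> {x\<in>S0. \<not> tree_output u0 x}
      \<le> sqrt (a * b) * tree_affinity \<mu> \<nu> t0 S0"
    using Node.IH(1)[of S0] Node.prems by auto
  obtain u1 where u1: "tree_on m u1" "\<And>x. num_queries u1 x = num_queries t1 x"
    "a * measure_pmf.prob \<mu> {x\<in>S1. tree_output u1 x} + b * measure_pmf.prob \<nu> {x\<in>S1. \<not> tree_output u1 x}
      \<le> sqrt (a * b) * tree_affinity \<mu> \<nu> t1 S1"
    using Node.IH(2)[of S1] Node.prems by auto
  let ?u = "Node i u0 u1"
  have split: "measure_pmf.prob \<kappa> {x\<in>S. P (tree_output ?u x)} =
      measure_pmf.prob \<kappa> {x\<in>S0. P (tree_output u0 x)} + measure_pmf.prob \<kappa> {x\<in>S1. P (tree_output u1 x)}"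
    for \<kappa> :: "bool list pmf" and P
  proof -
    have "{x\<in>S. P (tree_output ?u x)} = {x\<in>S0. P (tree_output u0 x)} \<union> {x\<in>S1. P (tree_output u1 x)}"
      by (auto simp: S0_def S1_def)
    then show ?thesis
      by (simp only:) (subst measure_pmf.finite_measure_Union, auto simp: S0_def S1_def)
  qed
  have "a * measure_pmf.prob \<mu> {x\<in>S. tree_output ?u x} + b * measure_pmf.prob \<nu> {x\<in>S. \<not> tree_output ?u x}
      \<le> sqrt (a * b) * tree_affinity \<mu> \<nu> (Node i t0 t1) S"
    using u0(3) u1(3) split[of \<mu> "\<lambda>b. b"] split[of \<nu> "\<lambda>b. \<not> b"]
    unfolding tree_affinity.simps S0_def[symmetric] S1_def[symmetric] by (simp add: algebra_simps)
  then show ?case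
    using u0 u1 Node.prems by (intro exI[of _ ?u]) auto
qed

section \<open>Distributions from weights, and multiplicative weights\<close>

text \<open>The total \<open>sum w X\<close> stays as a factor because it becomes the prior weight
  of one value of the function.\<close>

lemma normalized_weight_pmf:
  fixes w :: "'a \<Rightarrow> real"
  assumes "finite X" "X \<noteq> {}" "\<And>x. 0 < w x"
  obtains \<mu> where "set_pmf \<mu> = X" "\<And>A. sum w X * measure_pmf.prob \<mu> A = sum w (X \<inter> A)"
proof -
  define f where "f = (\<lambda>x. if x \<in> X then w x / sum w X else 0)"
  have W: "0 < sum w X"
    using assms by (intro sum_pos)
  have nonneg: "0 \<le> f x" for x
    using assms(3)[of x] W by (simp add: f_def)
  have "(\<integral>\<^sup>+ x. ennreal (f x) \<partial>count_space UNIV) = (\<Sum>x\<in>X. ennreal (f x))"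
    using assms(1) by (intro nn_integral_count_space') (auto simp: f_def)
  also have "\<dots> = ennreal (\<Sum>x\<in>X. f x)"
    by (rule sum_ennreal) (simp add: nonneg)
  also have "(\<Sum>x\<in>X. f x) = 1"
    using W by (simp add: f_def flip: sum_divide_distrib)
  finally have int: "(\<integral>\<^sup>+ x. ennreal (f x) \<partial>count_space UNIV) = 1" by simp
  show ?thesis
  proof
    show supp: "set_pmf (embed_pmf f) = X"
      unfolding set_embed_pmf[OF nonneg int]
      using W less_imp_neq[OF assms(3)] by (auto simp: f_def)
    fix A
    have "measure_pmf.prob (embed_pmf f) A = measure_pmf.prob (embed_pmf f) (X \<inter> A)"
      using measure_Int_set_pmf[of "embed_pmf f" A] supp by (simp add: Int_commute)
    also have "\<dots> = (\<Sum>x\<in>X \<inter> A. f x)"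
      using assms(1) by (simp add: measure_measure_pmf_finite pmf_embed_pmf[OF nonneg int])
    also have "\<dots> = sum w (X \<inter> A) / sum w X"
      by (simp add: f_def flip: sum_divide_distrib)
    finally show "sum w X * measure_pmf.prob (embed_pmf f) A = sum w (X \<inter> A)"
      using W by simp
  qed
qed

text \<open>Multiplicative weights in place of the minimax theorem: each round doubles the weight of the
  points that the current object handles badly, which multiplies the total weight by at most \<open>9/8\<close>,
  while a point that is bad in more than a third of the \<open>N\<close> rounds has weight at least
  \<open>2 powr (N/3)\<close>.\<close>

lemma multiplicative_weights:
  fixes bad :: "'t \<Rightarrow> 'a \<Rightarrow> bool"
  assumes "finite X"
    and weak: "\<And>w :: 'a \<Rightarrow> real. (\<And>x. 0 < w x) \<Longrightarrow> \<exists>t\<in>U. sum w {x\<in>X. bad t x} \<le> sum w X / 8"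
  shows "\<exists>p. set_pmf p \<subseteq> U \<and> (\<forall>x\<in>X. measure_pmf.prob p {t. \<not> bad t x} \<ge> 2/3)"
proof -
  obtain pick where pick: "\<And>w :: 'a \<Rightarrow> real. (\<And>x. 0 < w x) \<Longrightarrow>
      pick w \<in> U \<and> sum w {x\<in>X. bad (pick w) x} \<le> sum w X / 8"
    using weak by metis
  define W :: "nat \<Rightarrow> 'a \<Rightarrow> real" where
    "W n = rec_nat (\<lambda>x. 1) (\<lambda>_ w x. if bad (pick w) x then 2 * w x else w x) n" for n
  define t where "t n = pick (W n)" for n
  have W_0: "W 0 x = 1" and W_Suc: "W (Suc n) x = (if bad (t n) x then 2 * W n x else W n x)" for n x
    by (simp_all add: W_def t_def)
  have W_pos: "0 < W n x" for n x
    by (induction n) (simp_all add: W_0 W_Suc)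
  have W_eq: "W n x = 2 ^ card {i. i < n \<and> bad (t i) x}" for n x
  proof (induction n)
    case (Suc n)
    have "{i. i < Suc n \<and> bad (t i) x} = {i. i < n \<and> bad (t i) x} \<union> (if bad (t n) x then {n} else {})"
      by (auto simp: less_Suc_eq)
    then show ?case using Suc by (simp add: W_Suc)
  qed (simp add: W_0)
  have sum_W_le: "sum (W n) X \<le> (9/8) ^ n * card X" for n
  proof (induction n)
    case (Suc n)
    have "sum (W (Suc n)) X = (\<Sum>x\<in>X. W n x + (if bad (t n) x then W n x else 0))"
      by (intro sum.cong) (auto simp: W_Suc)
    also have "\<dots> = sum (W n) X + sum (W n) {x\<in>X. bad (t n) x}"
      using assms(1) by (simp add: sum.distrib sum.inter_filter)
    also have "\<dots> \<le> 9/8 * sum (W n) X"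
      using pick[OF W_pos] by (simp add: t_def)
    finally show ?case using Suc by simp
  qed (simp add: W_0)
  \<comment> \<open>The base is \<open>2 / (9/8) ^ 3\<close>, so \<open>2 ^ N\<close> exceeds the
    cube of the bound on the total weight.\<close>
  obtain N where N: "real (card X) ^ 3 < (1024/729) ^ N"
    using real_arch_pow[of "1024/729 :: real"] by auto
  have few: "3 * card {i. i < N \<and> bad (t i) x} \<le> N" if "x \<in> X" for x
  proof (rule ccontr)
    let ?e = "card {i. i < N \<and> bad (t i) x}"
    assume "\<not> 3 * ?e \<le> N"
    then have "(2::real) ^ N \<le> 2 ^ (3 * ?e)"
      by (intro power_increasing) auto
    also have "\<dots> = (W N x) ^ 3"
      by (simp add: W_eq mult.commute flip: power_mult)
    also have "\<dots> \<le> ((9/8) ^ N * card X) ^ 3"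
    proof (rule power_mono)
      have "W N x \<le> sum (W N) X"
        using that assms(1) W_pos by (intro member_le_sum) (auto intro: less_imp_le)
      then show "W N x \<le> (9/8) ^ N * card X"
        using sum_W_le[of N] by linarith
    qed (use W_pos less_imp_le in blast)
    also have "\<dots> = ((9/8) ^ 3) ^ N * real (card X) ^ 3"
      by (simp only: power_mult_distrib power_mult[symmetric] mult.commute)
    also have "(9/8 :: real) ^ 3 = 729/512"
      by (simp add: power3_eq_cube)
    also have "(729/512) ^ N * real (card X) ^ 3 < (729/512) ^ N * (1024/729) ^ N"
      using N by (intro mult_strict_left_mono) auto
    also have "\<dots> = 2 ^ N"
      by (simp flip: power_mult_distrib)
    finally show False by simp
  qed
  have U: "t n \<in> U" for n
    using pick[OF W_pos] by (simp add: t_def)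
  show ?thesis
  proof (cases "X = {}")
    case True
    \<comment> \<open>Here \<open>N\<close> may be 0, so a single object replaces the uniform choice
      of a round.\<close>
    then show ?thesis using U by (intro exI[of _ "return_pmf (t 0)"]) auto
  next
    case False
    have "0 < N"
    proof (rule ccontr)
      assume "\<not> 0 < N"
      moreover have "1 \<le> real (card X) ^ 3"
        using False assms(1) by (intro one_le_power) (simp add: Suc_le_eq card_gt_0_iff)
      ultimately show False using N by simp
    qed
    then have ne: "{..<N} \<noteq> {}" by auto
    \<comment> \<open>A uniformly random round: objects picked repeatedly are counted with
      multiplicity.\<close>
    let ?p = "map_pmf t (pmf_of_set {..<N})"
    have "2/3 \<le> measure_pmf.prob ?p {s. \<not> bad s x}" if "x \<in> X" for x
    proof -
      have "{..<N} = {..<N} \<inter> t -` {s. \<not> bad s x} \<union> {i. i < N \<and> bad (t i) x}"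
        by auto
      then have "N = card ({..<N} \<inter> t -` {s. \<not> bad s x}) + card {i. i < N \<and> bad (t i) x}"
        by (subst card_Un_disjoint[symmetric]) auto
      then have "2 * real N \<le> 3 * real (card ({..<N} \<inter> t -` {s. \<not> bad s x}))"
        using few[OF that] by linarith
      then show ?thesis
        using \<open>0 < N\<close> ne by (simp add: measure_pmf_of_set field_simps)
    qed
    then show ?thesis
      using U ne by (intro exI[of _ ?p]) auto
  qed
qed

section \<open>Upper bounds on randomized query complexity\<close>

lemma randomized_query_complexity_le:
  assumes "randomized_computes \<epsilon> m g A" "\<And>T x. T \<in> set_pmf A \<Longrightarrow> num_queries T x \<le> k"
  shows "randomized_query_complexity \<epsilon> m g \<le> k"
  unfolding randomized_query_complexity_def using assms by (intro Least_le) auto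

text \<open>An input outside both preimages is related to both outputs, so every tree is right on
  it.\<close>

lemma randomized_computes_iff_preimage:
  assumes "partial_boolean_function m g" "0 \<le> \<epsilon>"
  shows "randomized_computes \<epsilon> m g A \<longleftrightarrow> (\<forall>T\<in>set_pmf A. tree_on m T) \<and>
    (\<forall>b. \<forall>x\<in>preimage g b. measure_pmf.prob A {T. tree_output T x = b} \<ge> 1 - \<epsilon>)"
proof -
  have sub: "preimage g b \<subseteq> cube m" for b
    using assms(1) by (auto simp: partial_boolean_function_def preimage_def)
  have pre: "{T. (x, tree_output T x) \<in> g} = {T. tree_output T x = b}" if "x \<in> preimage g b" for x b
  proof -
    have "(x, c) \<in> g \<longleftrightarrow> c = b" for c
      using that by (cases b; cases c) (auto simp: preimage_def)
    then show ?thesis by simp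
  qed
  have valid: "{T. (x, tree_output T x) \<in> g} = UNIV" if x: "x \<in> cube m" "\<And>b. x \<notin> preimage g b" for x
  proof -
    obtain c where "(x, c) \<in> g"
      using x(1) assms(1) unfolding partial_boolean_function_def by blast
    moreover from this x(2)[of c] have "(x, \<not> c) \<in> g"
      by (simp add: preimage_def)
    ultimately have "(x, b) \<in> g" for b
      by (cases "b = c") auto
    then show ?thesis by auto
  qed
  have "(\<forall>x\<in>cube m. measure_pmf.prob A {T. (x, tree_output T x) \<in> g} \<ge> 1 - \<epsilon>) \<longleftrightarrow>
    (\<forall>b. \<forall>x\<in>preimage g b. measure_pmf.prob A {T. tree_output T x = b} \<ge> 1 - \<epsilon>)"
  proof safe
    fix b x assume "\<forall>x\<in>cube m. 1 - \<epsilon> \<le> measure_pmf.prob A {T. (x, tree_output T x) \<in> g}"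
      "x \<in> preimage g b"
    then show "1 - \<epsilon> \<le> measure_pmf.prob A {T. tree_output T x = b}"
      using sub[of b] by (auto simp flip: pre)
  next
    fix x assume *: "\<forall>b. \<forall>x\<in>preimage g b. 1 - \<epsilon> \<le> measure_pmf.prob A {T. tree_output T x = b}"
      "x \<in> cube m"
    show "1 - \<epsilon> \<le> measure_pmf.prob A {T. (x, tree_output T x) \<in> g}"
    proof (cases "\<exists>b. x \<in> preimage g b")
      case True
      then show ?thesis using * pre by auto
    next
      case False
      then show ?thesis using valid[OF *(2)] assms(2) by simp
    qed
  qed
  then show ?thesis by (simp add: randomized_computes_def)
qed

lemma finite_cube: "finite (cube m)"
  using finite_lists_length_eq[of "UNIV :: bool set" m] by (simp add: cube_def)

text \<open>Provides the weak learner for \<open>multiplicative_weights\<close>: a weighting of the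
  domain splits into one distribution per value and two prior weights.\<close>

lemma randomized_query_complexity_le_if_affinity:
  assumes g: "partial_boolean_function m g"
    and ne: "preimage g False \<noteq> {}" "preimage g True \<noteq> {}"
    and trees: "\<And>\<mu> \<nu>. set_pmf \<mu> \<subseteq> preimage g False \<Longrightarrow> set_pmf \<nu> \<subseteq> preimage g True \<Longrightarrow>
      \<exists>t. tree_on m t \<and> (\<forall>x. num_queries t x \<le> k) \<and> tree_affinity \<mu> \<nu> t UNIV \<le> 1/4"
  shows "randomized_query_complexity (1/3) m g \<le> k"
proof -
  define X0 X1 where "X0 = preimage g False" and "X1 = preimage g True"
  define U where "U = {t. tree_on m t \<and> (\<forall>x. num_queries t x \<le> k)}"
  define bad where "bad t x \<longleftrightarrow> tree_output t x \<noteq> (x \<in> X1)" for t x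
  have fin: "finite X0" "finite X1"
    using g by (auto simp: X0_def X1_def partial_boolean_function_def preimage_def
        intro: finite_subset[OF _ finite_cube[of m]])
  have disj: "X0 \<inter> X1 = {}"
    by (auto simp: X0_def X1_def preimage_def)
  have "\<exists>t\<in>U. sum w {x\<in>X0 \<union> X1. bad t x} \<le> sum w (X0 \<union> X1) / 8"
    if w: "\<And>x. 0 < w x" for w :: "bool list \<Rightarrow> real"
  proof -
    obtain \<mu> where \<mu>: "set_pmf \<mu> = X0" "\<And>A. sum w X0 * measure_pmf.prob \<mu> A = sum w (X0 \<inter> A)"
      using normalized_weight_pmf[OF fin(1), of w] ne w unfolding X0_def by blast
    obtain \<nu> where \<nu>: "set_pmf \<nu> = X1" "\<And>A. sum w X1 * measure_pmf.prob \<nu> A = sum w (X1 \<inter> A)"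
      using normalized_weight_pmf[OF fin(2), of w] ne w unfolding X1_def by blast
    define a b where "a = sum w X0" and "b = sum w X1"
    have ab: "0 \<le> a" "0 \<le> b"
      using w by (auto simp: a_def b_def intro!: sum_nonneg dest: less_imp_le)
    obtain t where t: "tree_on m t" "\<forall>x. num_queries t x \<le> k" "tree_affinity \<mu> \<nu> t UNIV \<le> 1/4"
      using trees[of \<mu> \<nu>] \<mu>(1) \<nu>(1) by (auto simp: X0_def X1_def)
    obtain u where u: "tree_on m u" "\<forall>x. num_queries u x = num_queries t x"
      "a * measure_pmf.prob \<mu> {x\<in>UNIV. tree_output u x} + b * measure_pmf.prob \<nu> {x\<in>UNIV. \<not> tree_output u x}
      \<le> sqrt (a * b) * tree_affinity \<mu> \<nu> t UNIV"
      using maximum_likelihood_relabelling[OF ab t(1)] by blast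
    have "{x\<in>X0 \<union> X1. bad u x} = (X0 \<inter> {x. tree_output u x}) \<union> (X1 \<inter> {x. \<not> tree_output u x})"
      using disj by (auto simp: bad_def)
    then have "sum w {x\<in>X0 \<union> X1. bad u x} =
        sum w (X0 \<inter> {x. tree_output u x}) + sum w (X1 \<inter> {x. \<not> tree_output u x})"
      using fin disj by (simp only:) (subst sum.union_disjoint, auto)
    also have "\<dots> \<le> sqrt (a * b) * tree_affinity \<mu> \<nu> t UNIV"
      using u(3) by (simp add: a_def b_def \<mu>(2) \<nu>(2))
    also have "\<dots> \<le> sqrt (a * b) * (1/4)"
      using t(3) ab by (intro mult_left_mono) auto
    \<comment> \<open>AM-GM turns the affinity bound 1/4 into the error 1/8 required of the weak
      learner.\<close>
    also have "\<dots> \<le> (a + b) / 2 * (1/4)"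
      using arith_geo_mean_sqrt[OF ab] by (intro mult_right_mono) auto
    also have "a + b = sum w (X0 \<union> X1)"
      using fin disj by (simp add: a_def b_def sum.union_disjoint)
    finally have "sum w {x\<in>X0 \<union> X1. bad u x} \<le> sum w (X0 \<union> X1) / 8" by simp
    moreover have "u \<in> U"
      using u t by (simp add: U_def)
    ultimately show ?thesis by blast
  qed
  then obtain A where A: "set_pmf A \<subseteq> U"
    "\<And>x. x \<in> X0 \<union> X1 \<Longrightarrow> 2/3 \<le> measure_pmf.prob A {t. \<not> bad t x}"
    using multiplicative_weights[of "X0 \<union> X1" U bad] fin by blast
  have "1 - 1/3 \<le> measure_pmf.prob A {T. tree_output T x = b}" if "x \<in> preimage g b" for b x
  proof -
    have "x \<in> X0 \<union> X1" "x \<in> X1 \<longleftrightarrow> b"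
      using that by (cases b; auto simp: X0_def X1_def preimage_def)+
    then show ?thesis using A(2)[of x] by (simp add: bad_def)
  qed
  moreover have "tree_on m T" if "T \<in> set_pmf A" for T
    using A(1) that by (auto simp: U_def)
  ultimately have "randomized_computes (1/3) m g A"
    by (simp add: randomized_computes_iff_preimage[OF g])
  then show ?thesis
    using A(1) by (intro randomized_query_complexity_le) (auto simp: U_def)
qed

text \<open>A constant tree with the other label never errs. This case has no admissible pair of
  distributions and is settled separately.\<close>

lemma randomized_query_complexity_constant:
  assumes "partial_boolean_function m g" "preimage g b = {}"
  shows "randomized_query_complexity (1/3) m g = 0"
proof -
  have "measure_pmf.prob (return_pmf (Leaf (\<not> b))) {T. tree_output T x = c} = 1" if "x \<in> preimage g c" for x c
  proof -
    have "c = (\<not> b)" using that assms(2) by (cases b; cases c) auto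
    then show ?thesis by simp
  qed
  then have "randomized_computes (1/3) m g (return_pmf (Leaf (\<not> b)))"
    by (simp add: randomized_computes_iff_preimage[OF assms(1)])
  then have "randomized_query_complexity (1/3) m g \<le> 0"
    by (rule randomized_query_complexity_le) auto
  then show ?thesis by simp
qed

section \<open>Choice of constants and the lower bound\<close>

text \<open>By \<open>1 - x \<le> exp (- x)\<close> the power is at most \<open>exp (- 2)\<close>,
  and \<open>exp 1 \<ge> 2\<close>.\<close>

lemma contraction_power_le_quarter:
  fixes D :: nat
  assumes "0 < D"
  shows "(1 - 1 / (16 * real D)) ^ (32 * D) \<le> 1/4"
proof -
  have "(1 - 1 / (16 * real D)) ^ (32 * D) \<le> exp (- (1 / (16 * real D))) ^ (32 * D)"
    using assms exp_ge_add_one_self[of "- (1 / (16 * real D))"] by (intro power_mono) (auto simp: field_simps)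
  also have "\<dots> = exp (real (32 * D) * - (1 / (16 * real D)))"
    by (rule exp_of_nat_mult[symmetric])
  also have "\<dots> = inverse (exp 1 ^ 2)"
    using assms by (simp add: exp_minus flip: exp_of_nat_mult)
  also have "\<dots> \<le> inverse (2 ^ 2)"
    using exp_ge_add_one_self[of 1] by (intro le_imp_inverse_le power_mono) auto
  finally show ?thesis by simp
qed

lemma randomized_query_complexity_le_conflict:
  assumes g: "partial_boolean_function m g"
    and ne: "preimage g False \<noteq> {}" "preimage g True \<noteq> {}"
    and D: "0 < D"
    and trees: "\<And>\<mu> \<nu>. set_pmf \<mu> \<subseteq> preimage g False \<Longrightarrow> set_pmf \<nu> \<subseteq> preimage g True \<Longrightarrow>
      \<exists>T. tree_on m T \<and> computes T g \<and> 2 * tree_conflict T \<mu> \<nu> \<le> real D"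
  shows "randomized_query_complexity (1/3) m g \<le> 32 * D\<^sup>2"
proof -
  let ?\<gamma> = "1 - 1 / (16 * real D)"
  have phase: "\<exists>t. tree_on m t \<and> (\<forall>x. num_queries t x \<le> D) \<and> tree_affinity \<mu> \<nu> t UNIV \<le> ?\<gamma>"
    if "set_pmf \<mu> \<subseteq> preimage g False" "set_pmf \<nu> \<subseteq> preimage g True" for \<mu> \<nu>
    using trees[OF that] tree_affinity_truncate_le[OF _ that] tree_on_truncate num_queries_truncate_le
    by meson
  have "0 \<le> ?\<gamma>" using D by (simp add: field_simps)
  note iterate = iterated_tree_affinity[OF phase this, where r = "32 * D"]
  show ?thesis
  proof (rule randomized_query_complexity_le_if_affinity[OF g ne])
    fix \<mu> \<nu> assume "set_pmf \<mu> \<subseteq> preimage g False" "set_pmf \<nu> \<subseteq> preimage g True"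
    from iterate[OF _ _ this] obtain t where t: "tree_on m t" "\<forall>x. num_queries t x \<le> 32 * D * D"
      "tree_affinity \<mu> \<nu> t UNIV \<le> ?\<gamma> ^ (32 * D)"
      by blast
    from t(3) contraction_power_le_quarter[OF D] have "tree_affinity \<mu> \<nu> t UNIV \<le> 1/4"
      by (rule order_trans)
    then show "\<exists>t. tree_on m t \<and> (\<forall>x. num_queries t x \<le> 32 * D\<^sup>2) \<and> tree_affinity \<mu> \<nu> t UNIV \<le> 1/4"
      using t(1,2) by (intro exI[of _ t]) (simp add: power2_eq_square mult.assoc)
  qed
qed

theorem theorem8:
  shows "\<exists>c::real. c > 0 \<and>
    (\<forall>(m::nat) (g::(bool list \<times> bool) set). partial_boolean_function m g \<longrightarrow>
       conflict_complexity m g \<ge> ennreal (c * sqrt (real (randomized_query_complexity (1/3) m g))))"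
proof (intro exI[of _ "1/30"] conjI allI impI)
  fix m g assume g: "partial_boolean_function m g"
  let ?R = "randomized_query_complexity (1/3) m g"
  show "ennreal (1/30 * sqrt (real ?R)) \<le> conflict_complexity m g"
  proof (cases "preimage g False = {} \<or> preimage g True = {}")
    case True
    then show ?thesis using randomized_query_complexity_constant[OF g] by auto
  next
    case False
    then have ne: "preimage g False \<noteq> {}" "preimage g True \<noteq> {}" by auto
    show ?thesis
    proof (cases "conflict_complexity m g")
      case (real q)
      have inf_le: "(INF T \<in> {T. tree_on m T \<and> computes T g}. ennreal (tree_conflict T \<mu> \<nu>)) \<le> ennreal q"
        if "set_pmf \<mu> \<subseteq> preimage g False" "set_pmf \<nu> \<subseteq> preimage g True" for \<mu> \<nu>
        unfolding real(2)[symmetric] conflict_complexity_def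
        using that by (intro SUP_upper2[of "(\<mu>, \<nu>)"]) auto
      \<comment> \<open>Point masses form an admissible pair, which gives \<open>q \<ge> 1\<close>;
        this absorbs the rounding in \<open>D\<close>.\<close>
      obtain x y where "x \<in> preimage g False" "y \<in> preimage g True"
        using ne by blast
      then have supp: "set_pmf (return_pmf x) \<subseteq> preimage g False" "set_pmf (return_pmf y) \<subseteq> preimage g True"
        by auto
      have "ennreal 1 \<le> (INF T \<in> {T. tree_on m T \<and> computes T g}.
          ennreal (tree_conflict T (return_pmf x) (return_pmf y)))"
        using supp by (intro INF_greatest ennreal_leI tree_conflict_ge_1) auto
      also note inf_le[OF supp]
      finally have q: "1 \<le> q"
        using real(1) by (simp add: ennreal_le_iff del: ennreal_1)
      \<comment> \<open>One factor 2 is for Markov, the other for the slack in the infimum.\<close>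
      define D where "D = nat \<lceil>4 * q\<rceil>"
      have D: "4 * q \<le> real D" "real D \<le> 5 * q"
        using q by (simp_all add: D_def) linarith+
      then have D_pos: "0 < D"
        using q by (cases D) auto
      have "\<exists>T. tree_on m T \<and> computes T g \<and> 2 * tree_conflict T \<mu> \<nu> \<le> real D"
        if "set_pmf \<mu> \<subseteq> preimage g False" "set_pmf \<nu> \<subseteq> preimage g True" for \<mu> \<nu>
      proof -
        \<comment> \<open>The strict bound yields an actual tree without having to show that the
          infimum is attained.\<close>
        have "(INF T \<in> {T. tree_on m T \<and> computes T g}. ennreal (tree_conflict T \<mu> \<nu>)) < ennreal (2 * q)"
          using q by (intro le_less_trans[OF inf_le[OF that]]) (simp add: ennreal_less_iff)
        then obtain T where T: "tree_on m T" "computes T g" "ennreal (tree_conflict T \<mu> \<nu>) < ennreal (2 * q)"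
          by (auto simp: INF_less_iff)
        then have "tree_conflict T \<mu> \<nu> < 2 * q"
          using q tree_conflict_ge_1[OF T(2) that] by (simp add: ennreal_less_iff)
        then show ?thesis using T D by (intro exI[of _ T]) auto
      qed
      then have "real ?R \<le> real (32 * D\<^sup>2)"
        unfolding of_nat_le_iff by (rule randomized_query_complexity_le_conflict[OF g ne D_pos])
      also have "\<dots> = 32 * (real D)\<^sup>2"
        by simp
      also have "\<dots> \<le> 32 * (5 * q)\<^sup>2"
        using D by (intro mult_left_mono power_mono) auto
      \<comment> \<open>\<open>32 * 25 = 800 \<le> 900\<close>, the source of the constant
        \<open>1/30\<close>.\<close>
      also have "\<dots> \<le> (30 * q)\<^sup>2"
        by (simp add: power_mult_distrib)
      finally have "sqrt (real ?R) \<le> 30 * q"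
        using q by (intro real_le_lsqrt) auto
      then show ?thesis
        unfolding real(2) by (intro ennreal_leI) simp
    qed simp
  qed
qed simp

end
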